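(* Let $k$ be a positive integer. There is a constant $C_k > 0$, depending only on $k$, such that for every real number $\theta$ and every positive integer $N$ there exist integers $a_1, \dots, a_k$ and $q_1, \dots, q_k$ with $1 \le q_1, \dots, q_k \le N$ such that \[ \left| \frac{a_1}{q_1} + \dots + \frac{a_k}{q_k} - \theta \right| \le C_k N^{-k}. \] *)

theory Defs
  imports Complex_Main
begin

end

theory Submission
  imports Defs
begin

text \<open>
  If the denominators are pairwise coprime, the sums of fractions are exactly the integer multiples
  of the reciprocal of their product, so \<open>\<theta>\<close> is approximated to within that reciprocal. It remains
  to find \<open>k\<close> pairwise coprime integers in an interval \<open>[c N, N]\<close> with \<open>c > 0\<close> depending only
  on \<open>k\<close>; as in Goedel's beta function, one takes \<open>1 + i \<cdot> k! \<cdot> t\<close> for \<open>1 \<le> i \<le> k\<close>.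
\<close>

text \<open>Induction on \<open>I\<close> by Bezout: with \<open>P\<close> the product over
  \<open>F\<close> and \<open>u * q x + v * P = 1\<close>, dividing
  \<open>m = (m * u) * q x + (m * v) * P\<close> by \<open>q x * P\<close> splits off
  \<open>m * v\<close> over \<open>q x\<close> and leaves \<open>m * u\<close> over \<open>P\<close>
  to the induction hypothesis. For this \<open>m\<close> must be arbitrary. On the empty set the
  claim would read \<open>0 = m\<close>, so the induction starts from singletons.\<close>

lemma sum_fractions_pairwise_coprime:
  fixes q :: "'a \<Rightarrow> int"
  assumes "finite I" "I \<noteq> {}" and "\<And>i. i \<in> I \<Longrightarrow> q i \<noteq> 0"
    and "\<And>i j. i \<in> I \<Longrightarrow> j \<in> I \<Longrightarrow> i \<noteq> j \<Longrightarrow> coprime (q i) (q j)"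
  shows "\<exists>a :: 'a \<Rightarrow> int. (\<Sum>i\<in>I. real_of_int (a i) / real_of_int (q i)) =
    real_of_int m / real_of_int (\<Prod>i\<in>I. q i)"
  using assms
proof (induction I arbitrary: m rule: finite_ne_induct)
  case (singleton x)
  show ?case by (rule exI[of _ "\<lambda>_. m"]) simp
next
  case (insert x F)
  define P where "P = (\<Prod>i\<in>F. q i)"
  have "q x \<noteq> 0" "P \<noteq> 0"
    using insert.prems(1) insert.hyps by (auto simp: P_def)
  have "coprime (q x) P"
    unfolding P_def using insert.prems(2) insert.hyps by (intro prod_coprime_right) auto
  then obtain u v where "u * q x + v * P = 1"
    using bezout_int[of "q x" P] by auto
  then have m: "m = (m * u) * q x + (m * v) * P"
    by (metis mult.assoc distrib_left mult.right_neutral)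
  obtain a where a: "(\<Sum>i\<in>F. real_of_int (a i) / real_of_int (q i)) = real_of_int (m * u) / real_of_int P"
    using insert.IH[of "m * u"] insert.prems unfolding P_def by auto
  have "(\<Sum>i\<in>F. real_of_int ((a(x := m * v)) i) / real_of_int (q i)) =
      (\<Sum>i\<in>F. real_of_int (a i) / real_of_int (q i))"
    using insert.hyps by (intro sum.cong) auto
  then have "(\<Sum>i\<in>insert x F. real_of_int ((a(x := m * v)) i) / real_of_int (q i)) =
      real_of_int (m * v) / real_of_int (q x) + real_of_int (m * u) / real_of_int P"
    using insert.hyps a by simp
  also have "\<dots> = real_of_int ((m * u) * q x + (m * v) * P) / (real_of_int (q x) * real_of_int P)"
    using \<open>q x \<noteq> 0\<close> \<open>P \<noteq> 0\<close> by (simp add: field_simps)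
  also have "\<dots> = real_of_int m / real_of_int (\<Prod>i\<in>insert x F. q i)"
    unfolding m[symmetric] using insert.hyps by (simp add: P_def)
  finally show ?case by blast
qed

text \<open>Eliminating \<open>t\<close> shows that a common divisor divides \<open>j - i\<close>,
  which divides \<open>fact k\<close> since \<open>0 < j - i \<le> k\<close>; it then divides
  \<open>i * fact k * t\<close>, hence also 1.\<close>

lemma coprime_arith_progression_fact:
  fixes t :: int
  assumes "1 \<le> i" "i < j" "j \<le> k"
  shows "coprime (1 + int i * fact k * t) (1 + int j * fact k * t)"
proof (rule coprimeI)
  fix d :: int
  assume d: "d dvd 1 + int i * fact k * t" "d dvd 1 + int j * fact k * t"
  have "d dvd int j * (1 + int i * fact k * t) - int i * (1 + int j * fact k * t)"
    using d by (intro dvd_diff dvd_mult)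
  also have "\<dots> = int (j - i)"
    using assms by (simp add: algebra_simps of_nat_diff)
  also have "int (j - i) dvd int (fact k)"
    using assms by (subst of_nat_dvd_iff, intro dvd_fact) auto
  finally have "d dvd int i * fact k * t"
    by simp
  with d(1) show "is_unit d"
    by (simp add: dvd_add_left_iff)
qed

lemma exists_pairwise_coprime_comparable:
  fixes k N :: nat
  assumes "k \<ge> 1" "N \<ge> 1"
  obtains q :: "nat \<Rightarrow> int"
  where "\<And>i. i \<in> {1..k} \<Longrightarrow> 1 \<le> q i \<and> q i \<le> int N \<and> int N \<le> int (k * fact k) * q i"
    and "\<And>i j. i \<in> {1..k} \<Longrightarrow> j \<in> {1..k} \<Longrightarrow> i \<noteq> j \<Longrightarrow> coprime (q i) (q j)"
proof -
  \<comment> \<open>The largest \<open>t\<close> for which the last term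
    \<open>1 + k * fact k * t\<close> is still at most \<open>N\<close>. For
    \<open>N \<le> k * fact k\<close> it is 0 and every \<open>q i\<close> is 1.\<close>
  define t where "t = (N - 1) div (k * fact k)"
  define q where "q i = 1 + int i * fact k * int t" for i
  have "1 \<le> q i \<and> q i \<le> int N \<and> int N \<le> int (k * fact k) * q i" if i: "i \<in> {1..k}" for i
  proof (intro conjI)
    show "1 \<le> q i" by (simp add: q_def)
    have "i * fact k * t \<le> (k * fact k) * t"
      using i by (intro mult_right_mono) auto
    also have "\<dots> \<le> N - 1"
      unfolding t_def by (rule times_div_less_eq_dividend)
    finally have "1 + i * fact k * t \<le> N" using assms by simp
    then have "int (1 + i * fact k * t) \<le> int N" by (simp only: of_nat_le_iff)
    then show "q i \<le> int N" by (simp add: q_def)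
    have "N - 1 < k * fact k * (t + 1)"
      unfolding t_def using assms dividend_less_times_div[of "k * fact k" "N - 1"] by simp
    \<comment> \<open>The strict bound on \<open>N - 1\<close> absorbs the 1. The factors
      \<open>1 * 1\<close> are written out to be compared with \<open>i * fact k\<close>
      monotonically.\<close>
    then have "N \<le> k * fact k * (1 + 1 * 1 * t)" by simp
    also have "\<dots> \<le> k * fact k * (1 + i * fact k * t)"
      using i by (intro mult_left_mono add_left_mono mult_right_mono mult_mono) (auto simp: fact_ge_1)
    finally have "int N \<le> int (k * fact k * (1 + i * fact k * t))" by (simp only: of_nat_le_iff)
    then show "int N \<le> int (k * fact k) * q i" by (simp add: q_def distrib_left)
  qed
  moreover have "coprime (q i) (q j)" if "i \<in> {1..k}" "j \<in> {1..k}" "i \<noteq> j" for i j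
    using that coprime_arith_progression_fact[of i j k "int t"]
      coprime_arith_progression_fact[of j i k "int t"]
    by (cases "i < j") (auto simp: q_def coprime_commute)
  ultimately show thesis by (rule that)
qed

theorem theorem2:
  fixes k :: nat
  assumes "k \<ge> 1"
  shows "\<exists>C::real. C > 0 \<and>
    (\<forall>(\<theta>::real) (N::nat). N \<ge> 1 \<longrightarrow>
      (\<exists>(a :: nat \<Rightarrow> int) (q :: nat \<Rightarrow> int).
        (\<forall>i\<in>{1..k}. 1 \<le> q i \<and> q i \<le> int N) \<and>
        \<bar>(\<Sum>i=1..k. real_of_int (a i) / real_of_int (q i)) - \<theta>\<bar> \<le> C * real N powi (- int k)))"
\<comment> \<open>Each \<open>q i\<close> is at least \<open>N / (k * fact k)\<close>, so the
  reciprocal of the product of all \<open>k\<close> of them is at most this constant times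
  \<open>N\<close> to the power \<open>-k\<close>.\<close>
proof (intro exI[of _ "real (k * fact k) ^ k"] conjI allI impI)
  show "real (k * fact k) ^ k > 0" using assms by simp
  fix \<theta> :: real and N :: nat
  assume N: "N \<ge> 1"
  obtain q where q: "\<And>i. i \<in> {1..k} \<Longrightarrow> 1 \<le> q i \<and> q i \<le> int N \<and> int N \<le> int (k * fact k) * q i"
    and coprime: "\<And>i j. i \<in> {1..k} \<Longrightarrow> j \<in> {1..k} \<Longrightarrow> i \<noteq> j \<Longrightarrow> coprime (q i) (q j)"
    using exists_pairwise_coprime_comparable[OF assms N] by metis
  define P where "P = real_of_int (\<Prod>i\<in>{1..k}. q i)"
  have "P > 0"
    unfolding P_def of_int_0_less_iff using q by (intro prod_pos) fastforce
  \<comment> \<open>Rounding \<open>\<theta> * P\<close> down gives a multiple of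
    \<open>1 / P\<close> within \<open>1 / P\<close> of \<open>\<theta>\<close>.\<close>
  have "\<exists>a :: nat \<Rightarrow> int. (\<Sum>i\<in>{1..k}. real_of_int (a i) / real_of_int (q i)) =
      real_of_int \<lfloor>\<theta> * P\<rfloor> / P"
    unfolding P_def
  proof (rule sum_fractions_pairwise_coprime)
    show "q i \<noteq> 0" if "i \<in> {1..k}" for i using q[OF that] by auto
  qed (use assms coprime in auto)
  then obtain a :: "nat \<Rightarrow> int"
    where a: "(\<Sum>i=1..k. real_of_int (a i) / real_of_int (q i)) = real_of_int \<lfloor>\<theta> * P\<rfloor> / P"
    by blast
  have "(\<Prod>i\<in>{1..k}. int N) \<le> (\<Prod>i\<in>{1..k}. int (k * fact k) * q i)"
    using q by (intro prod_mono) auto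
  then have "int N ^ k \<le> int (k * fact k) ^ k * (\<Prod>i\<in>{1..k}. q i)"
    by (simp add: prod.distrib)
  then have "real_of_int (int N ^ k) \<le> real_of_int (int (k * fact k) ^ k * (\<Prod>i\<in>{1..k}. q i))"
    by (simp only: of_int_le_iff)
  then have NP: "real N ^ k \<le> real (k * fact k) ^ k * P"
    by (simp add: P_def)
  have "\<bar>real_of_int \<lfloor>\<theta> * P\<rfloor> / P - \<theta>\<bar> = \<bar>real_of_int \<lfloor>\<theta> * P\<rfloor> - \<theta> * P\<bar> / P"
    using \<open>P > 0\<close> by (simp add: field_simps abs_if)
  also have "\<dots> \<le> 1 / P"
    using \<open>P > 0\<close> by (intro divide_right_mono) linarith+
  also have "\<dots> \<le> real (k * fact k) ^ k * real N powi (- int k)"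
    using NP \<open>P > 0\<close> N by (simp add: power_int_minus field_simps)
  finally show "\<exists>(a :: nat \<Rightarrow> int) (q :: nat \<Rightarrow> int).
      (\<forall>i\<in>{1..k}. 1 \<le> q i \<and> q i \<le> int N) \<and>
      \<bar>(\<Sum>i=1..k. real_of_int (a i) / real_of_int (q i)) - \<theta>\<bar>
        \<le> real (k * fact k) ^ k * real N powi (- int k)"
    using a q by (intro exI[of _ a] exI[of _ q]) auto
qed

end
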